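(* Let $k\geq2$ be an integer and let $a\in\mathbb{C}\setminus\{0,-1,-2,\ldots\}$. In a neighborhood of $s=1-2k$ we have $$\zeta_H(s,a)=\frac{\zeta(1-2k)}{s+2k-1}+\gamma_{H,1-2k}(0,a)+O(s+2k-1),$$ where $$\gamma_{H,1-2k}(0,a)=\frac12\zeta(2-2k,a)-\psi(2k)\zeta(1-2k)-\bigl(\psi(1)-\psi(a)\bigr)\frac{B_{2k}}{2k}-\frac{1}{2k}\sum_{n=1}^{k}\binom{2k}{2n}\zeta(1-2n,a)B_{2k-2n}.$$
   Context: $H_n(a)=\sum_{k=0}^n\frac1{k+a}$ and $\zeta_H(s,a)=\sum_{n=0}^\infty\frac{H_n(a)}{(n+a)^s}$ for $\operatorname{Re}(s)>1$; the same symbol denotes its meromorphic continuation to the complex $s$-plane. $\zeta(s,a)$ is the (analytically continued) Hurwitz zeta function $\sum_{n=0}^\infty(n+a)^{-s}$, $\zeta(s)=\zeta(s,1)$ is the Riemann zeta function, $\psi=\Gamma'/\Gamma$, and $B_n$ are the Bernoulli numbers, $\frac{z}{e^z-1}=\sum_{n\ge0}B_n\frac{z^n}{n!}$. *)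

theory Defs
  imports "HOL-Complex_Analysis.Complex_Analysis" "HOL-Library.Landau_Symbols"
begin

text \<open>
  The meromorphic continuation to the whole plane of a function given on \<open>S\<close>.
  Requiring \<^const>\<open>nicely_meromorphic_on\<close> (removable singularities are removed and the value
  at a pole is 0) makes it unique when \<open>S\<close> is a nonempty open set; see
  \<open>meromorphic_continuation_eqI\<close> below.
\<close>

definition meromorphic_continuation :: "complex set \<Rightarrow> (complex \<Rightarrow> complex) \<Rightarrow> complex \<Rightarrow> complex" where
  "meromorphic_continuation S f =
     (THE g. g nicely_meromorphic_on UNIV \<and> (\<forall>s\<in>S. g s = f s))"

lemma nicely_meromorphic_on_UNIV_eqI:
  assumes f: "f nicely_meromorphic_on UNIV" and g: "g nicely_meromorphic_on UNIV"
    and S: "open S" "S \<noteq> {}" and eq: "\<And>s. s \<in> S \<Longrightarrow> f s = g s"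
  shows "f = g"
proof
  fix z
  define h where "h = remove_sings (\<lambda>s. f s - g s)"
  have mero: "(\<lambda>s. f s - g s) meromorphic_on UNIV"
    using f g unfolding nicely_meromorphic_on_def by (intro meromorphic_intros) auto
  have h: "h nicely_meromorphic_on UNIV"
    unfolding h_def by (rule remove_sings_nicely_meromorphic[OF mero])
  have iso: "isolated_singularity_at (\<lambda>s. f s - g s) w" for w
    using mero meromorphic_on_isolated_singularity meromorphic_on_subset by blast
  obtain z0 where z0: "z0 \<in> S"
    using S by blast
  have near: "\<forall>\<^sub>F w in at w0. h w = f w - g w" for w0
    unfolding h_def using iso[of w0] by (rule eventually_remove_sings_eq_at)
  have "\<forall>\<^sub>F w in at z0. w \<in> S"
    using S(1) z0 by (simp add: eventually_at_topological) blast
  hence "\<forall>\<^sub>F w in at z0. h w = 0"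
    using near[of z0] by eventually_elim (simp add: eq)
  hence freq: "\<exists>\<^sub>F w in at z0. h w = 0"
    by (intro eventually_frequently) auto
  have h0: "h w = 0" for w
    using frequently_eq_meromorphic_imp_constant[OF freq h] by auto
  have ev: "\<forall>\<^sub>F w in at z. f w = g w"
    using near[of z] by eventually_elim (simp add: h0)
  have pole: "is_pole f z = is_pole g z"
    by (rule is_pole_cong[OF ev refl])
  have lim: "f \<midarrow>z\<rightarrow> c \<longleftrightarrow> g \<midarrow>z\<rightarrow> c" for c
    by (rule tendsto_cong[OF ev])
  show "f z = g z"
  proof (cases "is_pole f z")
    case True
    hence "\<not> g \<midarrow>z\<rightarrow> c" "\<not> f \<midarrow>z\<rightarrow> c" for c
      using pole lim not_tendsto_and_filterlim_at_infinity[of "at z" f c]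
      by (auto simp: is_pole_def)
    thus ?thesis
      using f g unfolding nicely_meromorphic_on_def by (metis UNIV_I)
  next
    case False
    hence "f \<midarrow>z\<rightarrow> f z" "g \<midarrow>z\<rightarrow> g z"
      using pole f g unfolding nicely_meromorphic_on_def by (metis UNIV_I)+
    thus ?thesis
      using lim LIM_unique by blast
  qed
qed

lemma meromorphic_continuation_eqI:
  assumes "g nicely_meromorphic_on UNIV" "open S" "S \<noteq> {}" "\<And>s. s \<in> S \<Longrightarrow> g s = f s"
  shows "meromorphic_continuation S f = g"
  unfolding meromorphic_continuation_def
  using assms by (intro the_equality) (auto intro!: nicely_meromorphic_on_UNIV_eqI[of _ _ S])

text \<open>All complex powers are principal: \<open>w powr s = exp (s * Ln w)\<close> for \<open>w \<noteq> 0\<close>.\<close>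

definition hurwitz_zeta :: "complex \<Rightarrow> complex \<Rightarrow> complex" where
  "hurwitz_zeta s a =
     meromorphic_continuation {s. Re s > 1} (\<lambda>s. \<Sum>n. (of_nat n + a) powr (- s)) s"

definition riemann_zeta :: "complex \<Rightarrow> complex" where
  "riemann_zeta s = hurwitz_zeta s 1"

definition shifted_harm :: "nat \<Rightarrow> complex \<Rightarrow> complex" where
  "shifted_harm n a = (\<Sum>k=0..n. 1 / (of_nat k + a))"

definition harmonic_zeta :: "complex \<Rightarrow> complex \<Rightarrow> complex" where
  "harmonic_zeta s a =
     meromorphic_continuation {s. Re s > 1}
       (\<lambda>s. \<Sum>n. shifted_harm n a / (of_nat n + a) powr s) s"

text \<open>\<open>z / (e\<^sup>z - 1) = (\<Sum>n. B\<^sub>n z\<^sup>n / n!)\<close>, so in particular \<open>B\<^sub>1 = -1/2\<close>.\<close>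

definition bernoulli :: "nat \<Rightarrow> complex" where
  "bernoulli n = fact n * fps_nth (fps_X / (fps_exp 1 - 1)) n"

definition harmonic_zeta_gamma0 :: "nat \<Rightarrow> complex \<Rightarrow> complex" where
  "harmonic_zeta_gamma0 k a =
     1 / 2 * hurwitz_zeta (2 - 2 * of_nat k) a
     - Digamma (2 * of_nat k) * riemann_zeta (1 - 2 * of_nat k)
     - (Digamma 1 - Digamma a) * (bernoulli (2 * k) / (2 * of_nat k))
     - 1 / (2 * of_nat k) *
         (\<Sum>n=1..k. of_nat ((2 * k) choose (2 * n)) * hurwitz_zeta (1 - 2 * of_nat n) a
                     * bernoulli (2 * k - 2 * n))"

end

(*
  Write w = 1 - s and truncate the generalised Bernoulli polynomial
  B_w(x) = sum_j (w gchoose j) B_j x^(w-j) at j = M.  The defect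
  B_w(x+1) - B_w(x) - w x^(w-1) is O(|x|^(Re w - M - 2)), and it vanishes when w is a positive
  integer at most M.  Summation by parts against the coefficients 1 and H_n(a) gives
    -w zeta(1-w, a)   = B_w(a) + sum_n defect(n+a),
    -w zeta_H(1-w, a) = sum_(j<=M) (w gchoose j) B_j zeta(1-w+j, a) + sum_n H_n(a) defect(n+a),
  which continue both functions to Re w < M + 1.  At w = 2k with M = 2k the last series vanishes
  and only the term j = 2k has a pole, coming from zeta(s,a) = 1/(s-1) - psi(a) + O(s-1); the
  derivative of (w gchoose 2k) at w = 2k is the harmonic number that turns into psi(2k).
*)
theory Submission
  imports Defs "HOL-Real_Asymp.Real_Asymp"
begin

section \<open>Bernoulli numbers and binomial coefficients\<close>

text \<open>The branch of the powers is the obstacle: for complex a, finitely many n + a may lie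
  outside the right half plane, where \<open>(x + 1) powr v\<close> need not equal its binomial
  series. The defect is therefore defined as an exact difference, so that summation by parts holds
  for every n, while its series and its decay are used only for Re x > 0 and |x| large. Each of the
  finitely many other terms is entire in w and does no harm. Both identities are proved for Re w <
  0, where the boundary terms tend to 0 and the Dirichlet series converge; the identity theorem
  carries them further. M = 2k is the smallest truncation whose half plane Re w < M + 1 contains w =
  2k. The expansion of zeta(s,a) at its pole comes from the same formula with M = 0: the defect is
  then (x+1)^w - x^w - w x^(w-1), and its derivative at w = 0 is Ln(x+1) - Ln x - 1/x, whose sum
  over x = n + a is governed by the limit formula for psi.\<close>

lemma bernoulli_fps: "fps_X / (fps_exp 1 - 1) * (fps_exp 1 - 1) = (fps_X :: complex fps)"
proof (rule fps_times_divide_eq)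
  have *: "fps_nth (fps_exp 1 - 1 :: complex fps) 1 = 1"
    by simp
  then show "fps_exp 1 - 1 \<noteq> (0 :: complex fps)"
    by (metis fps_zero_nth zero_neq_one)
  \<comment> \<open>A quotient of formal power series is exact only when the divisor has no larger
    subdegree than the dividend; here both have subdegree 1.\<close>
  show "subdegree (fps_X :: complex fps) \<ge> subdegree (fps_exp 1 - 1 :: complex fps)"
    using subdegree_leI[of "fps_exp 1 - 1 :: complex fps" 1] * by simp
qed

text \<open>Compare the coefficients of z^n in P(z) (e^z - 1) = z. The term j = n drops out because
  e^z - 1 has no constant term. The exceptional case n = 1 later produces the term w x^(w-1) of the
  difference equation.\<close>

lemma sum_binomial_bernoulli:
  "(\<Sum>j<n. of_nat (n choose j) * bernoulli j) = (if n = 1 then 1 else 0)"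
proof -
  define P where "P = (fps_X / (fps_exp 1 - 1) :: complex fps)"
  have "fps_nth (P * (fps_exp 1 - 1)) n = (\<Sum>j\<le>n. fps_nth P j * (1 / fact (n - j) - (if n = j then 1 else 0)))"
    by (auto simp: fps_mult_nth atLeast0AtMost intro!: sum.cong)
  also have "\<dots> = (\<Sum>j<n. fps_nth P j * (1 / fact (n - j)))"
    by (simp add: lessThan_Suc_atMost[symmetric])
  also have "fact n * \<dots> = (\<Sum>j<n. of_nat (n choose j) * bernoulli j)"
    unfolding sum_distrib_left
    by (intro sum.cong) (auto simp: bernoulli_def P_def binomial_fact field_simps)
  finally have "(\<Sum>j<n. of_nat (n choose j) * bernoulli j) = fact n * fps_nth fps_X n"
    by (simp add: P_def bernoulli_fps)
  then show ?thesis
    by (simp add: fps_X_nth)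
qed

lemma bernoulli_0: "bernoulli 0 = 1"
  using sum_binomial_bernoulli[of 1] by simp

lemma bernoulli_1: "bernoulli 1 = -1/2"
  using sum_binomial_bernoulli[of 2] by (simp add: numeral_2_eq_2 bernoulli_0 eq_neg_iff_add_eq_0 field_simps)

text \<open>Substituting -z into P(z) = z/(e^z - 1) and multiplying by e^z gives P(-z) = P(z) + z,
  so odd coefficients other than the first equal their own negatives.\<close>

lemma bernoulli_odd:
  assumes "odd n" "n \<noteq> 1"
  shows "bernoulli n = 0"
proof -
  define P where "P = (fps_X / (fps_exp 1 - 1) :: complex fps)"
  define E where "E = (fps_exp 1 :: complex fps)"
  have P: "P * (E - 1) = fps_X"
    by (simp add: P_def E_def bernoulli_fps)
  have "(P oo (- fps_X)) * (fps_exp (-1) - 1) = - fps_X"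
    using arg_cong[OF P, of "\<lambda>f. f oo (- fps_X)"]
    by (simp add: fps_compose_mult_distrib fps_compose_sub_distrib E_def)
  then have "(P oo (- fps_X)) * (fps_exp (-1) - 1) * E = - (fps_X * E)"
    by simp
  moreover have "(fps_exp (-1) - 1) * E = 1 - E"
    using fps_exp_add_mult[of "-1 :: complex" 1] by (simp add: E_def algebra_simps)
  ultimately have "(P oo (- fps_X)) * (E - 1) = fps_X * E"
    by (metis (no_types, opaque_lifting) minus_diff_eq minus_equation_iff mult.assoc mult_minus_right)
  also have "\<dots> = (P + fps_X) * (E - 1)"
    by (simp add: algebra_simps P[symmetric])
  finally have "(P oo (- fps_X)) = P + fps_X"
    using P by (metis fps_X_neq_zero mult_cancel_right mult_zero_right)
  then have "fps_nth (P oo (- fps_X)) n = fps_nth (P + fps_X) n"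
    by simp
  then show ?thesis
    using assms by (simp add: fps_compose_uminus' bernoulli_def P_def[symmetric])
qed

text \<open>Each factor w - i has norm at most W + i, so the coefficient is dominated by (W + n
  choose n). The crude exponential rate suffices, since it is beaten by |x|^(-n) for large
  |x|.\<close>

lemma norm_gbinomial_le:
  fixes w :: complex
  assumes "norm w \<le> real W"
  shows "norm (w gchoose n) \<le> 2 ^ (W + n)"
proof -
  have "norm (w gchoose n) \<le> real ((W + n) choose n)"
  proof (induction n)
    case (Suc n)
    have "real (Suc n) * norm (w gchoose Suc n) = norm (w - of_nat n) * norm (w gchoose n)"
      using gbinomial_mult_1[of w n]
      by (metis (no_types, lifting) add_diff_cancel_left' left_diff_distrib norm_mult norm_of_nat)
    also have "\<dots> \<le> real (Suc (W + n)) * real ((W + n) choose n)"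
    proof (intro mult_mono Suc)
      show "norm (w - of_nat n) \<le> real (Suc (W + n))"
        using assms norm_triangle_ineq4[of w "of_nat n"] by simp
    qed auto
    also have "\<dots> = real (Suc n) * real ((W + Suc n) choose Suc n)"
      using Suc_times_binomial[of n "W + n"] by (metis add_Suc_right of_nat_mult)
    finally show ?case
      by (subst (asm) mult_le_cancel_left_pos) auto
  qed auto
  also have "\<dots> \<le> real (2 ^ (W + n))"
    by (rule of_nat_mono[OF binomial_le_pow2])
  finally show ?thesis by simp
qed

section \<open>The difference equation of truncated Bernoulli polynomials of complex order\<close>

text \<open>Factor x + 1 = x (1 + 1/x) and use the binomial series in 1/x. For Re x > 0 both factors
  lie in the right half plane, so their arguments add without leaving the principal range.\<close>

lemma powr_plus_1_sums:
  fixes x v :: complex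
  assumes "Re x > 0" "norm x > 1"
  shows "(\<lambda>i. (v gchoose i) * x powr (v - of_nat i)) sums (x + 1) powr v"
proof -
  have x: "x \<noteq> 0" using assms by auto
  have re: "Re (1 + 1 / x) > 0"
    using assms(1) by (simp add: Re_divide_numeral Re_divide add_pos_nonneg)
  then have y: "1 + 1 / x \<noteq> 0" by (metis less_irrefl zero_complex.simps(1))
  have "Ln (x * (1 + 1 / x)) = Ln x + Ln (1 + 1 / x)"
    using x y Re_Ln_pos_lt[OF x] Re_Ln_pos_lt[OF y] assms(1) re
    by (intro Ln_times_simple) auto
  moreover have "x * (1 + 1 / x) = x + 1" using x by (simp add: field_simps)
  moreover have "x + 1 \<noteq> 0" using assms(1) by (auto simp: complex_eq_iff)
  ultimately have eq: "(x + 1) powr v = x powr v * (1 + 1 / x) powr v"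
    using x y by (simp add: powr_def exp_add ring_distribs)
  have "norm (1 / x) < 1" using assms(2) by (simp add: norm_divide divide_less_eq)
  from sums_mult[OF gen_binomial_complex[OF this, of v], of "x powr v"]
  show ?thesis
    unfolding eq by (rule sums_cong[THEN iffD1, rotated])
      (use x in \<open>simp add: powr_diff powr_nat power_divide\<close>)
qed

definition bernoulli_powr :: "nat \<Rightarrow> complex \<Rightarrow> complex \<Rightarrow> complex" where
  "bernoulli_powr M w x = (\<Sum>j\<le>M. (w gchoose j) * bernoulli j * x powr (w - of_nat j))"

definition bernoulli_defect :: "nat \<Rightarrow> complex \<Rightarrow> complex \<Rightarrow> complex" where
  "bernoulli_defect M w x = bernoulli_powr M w (x + 1) - bernoulli_powr M w x - w * x powr (w - 1)"

text \<open>Expand each (x+1)^(w-j) and collect by the total exponent n = i + j, using (w choose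
  j)(w-j choose i) = (w choose n)(n choose j). For n up to M + 1 the inner sum is the complete
  Bernoulli sum over j < n, so only n = 1 survives, and it cancels w x^(w-1).\<close>

lemma bernoulli_defect_sums:
  assumes "Re x > 0" "norm x > 1"
  shows "(\<lambda>n. if n \<le> M + 1 then 0 else
            (w gchoose n) * (\<Sum>j\<le>M. of_nat (n choose j) * bernoulli j) * x powr (w - of_nat n))
         sums bernoulli_defect M w x"
proof -
  define t where "t = (\<lambda>j n. if n > j then (w gchoose n) * of_nat (n choose j) * bernoulli j * x powr (w - of_nat n) else 0)"
  have t: "t j sums ((w gchoose j) * bernoulli j * ((x + 1) powr (w - of_nat j) - x powr (w - of_nat j)))" for j
  proof -
    define f where "f = (\<lambda>i. (w - of_nat j gchoose i) * x powr (w - of_nat j - of_nat i))"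
    have "f sums (x + 1) powr (w - of_nat j)"
      unfolding f_def by (rule powr_plus_1_sums[OF assms])
    then have "(\<lambda>i. f (Suc i)) sums ((x + 1) powr (w - of_nat j) - x powr (w - of_nat j))"
      by (subst sums_Suc_iff) (simp add: f_def)
    then have "(\<lambda>i. (w gchoose j) * bernoulli j * f (Suc i)) sums
        ((w gchoose j) * bernoulli j * ((x + 1) powr (w - of_nat j) - x powr (w - of_nat j)))"
      by (rule sums_mult)
    also have "(\<lambda>i. (w gchoose j) * bernoulli j * f (Suc i)) = (\<lambda>i. t j (i + Suc j))"
    proof
      fix i
      have "(w gchoose (i + Suc j)) * of_nat ((i + Suc j) choose j) = (w gchoose j) * (w - of_nat j gchoose Suc i)"
        using gbinomial_trinomial_revision[of j "i + Suc j" w] by (simp add: binomial_gbinomial)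
      then show "(w gchoose j) * bernoulli j * f (Suc i) = t j (i + Suc j)"
        by (simp add: t_def f_def algebra_simps)
    qed
    finally show ?thesis
      by (subst (asm) sums_iff_shift) (simp add: t_def)
  qed
  have "(\<lambda>n. \<Sum>j\<le>M. t j n) sums (bernoulli_powr M w (x + 1) - bernoulli_powr M w x)"
    using sums_sum[of "{..M}" t, OF t]
    by (simp add: bernoulli_powr_def sum_subtractf ring_distribs)
  from sums_diff[OF this sums_single[of 1 "\<lambda>_. w * x powr (w - 1)"]]
  have "(\<lambda>n. (\<Sum>j\<le>M. t j n) - (if n = 1 then w * x powr (w - 1) else 0)) sums bernoulli_defect M w x"
    by (simp add: bernoulli_defect_def)
  also have "(\<lambda>n. (\<Sum>j\<le>M. t j n) - (if n = 1 then w * x powr (w - 1) else 0)) =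
    (\<lambda>n. if n \<le> M + 1 then 0 else
            (w gchoose n) * (\<Sum>j\<le>M. of_nat (n choose j) * bernoulli j) * x powr (w - of_nat n))"
  proof
    fix n
    have "(\<Sum>j\<le>M. t j n) = (w gchoose n) * x powr (w - of_nat n) *
            (\<Sum>j\<in>{..M} \<inter> {..<n}. of_nat (n choose j) * bernoulli j)"
      unfolding sum_distrib_left
      by (intro sum.mono_neutral_cong_right) (auto simp: t_def)
    moreover have "{..M} \<inter> {..<n} = (if n \<le> M + 1 then {..<n} else {..M})" by auto
    ultimately show "(\<Sum>j\<le>M. t j n) - (if n = 1 then w * x powr (w - 1) else 0) =
       (if n \<le> M + 1 then 0 else
            (w gchoose n) * (\<Sum>j\<le>M. of_nat (n choose j) * bernoulli j) * x powr (w - of_nat n))"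
      by (auto simp: sum_binomial_bernoulli)
  qed
  finally show ?thesis .
qed

lemma norm_powr_le:
  fixes x v :: complex
  shows "norm (x powr v) \<le> norm x powr Re v * exp (pi * norm v)"
proof -
  have "- Im v * Arg x \<le> \<bar>Im v\<bar> * \<bar>Arg x\<bar>"
    by (metis abs_ge_self abs_minus_cancel abs_mult)
  also have "\<dots> \<le> norm v * pi"
    using abs_Im_le_cmod[of v] Arg_bounded[of x] by (intro mult_mono) auto
  finally show ?thesis
    unfolding norm_powr_complex by (intro mult_left_mono) (auto simp: mult.commute)
qed

text \<open>The series starts at n = M + 2. Its coefficients grow at most like 4^n: one factor 2^n
  from \<open>w gchoose n\<close>, one from the binomials in the Bernoulli sum. Hence |x| >= 8 gives
  a geometric ratio of 1/2. The constant depends on w only through W, which makes the bound locally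
  uniform.\<close>

lemma norm_bernoulli_defect_le:
  obtains K where "K > 0"
    "\<And>w x. norm w \<le> real W \<Longrightarrow> Re x > 0 \<Longrightarrow> norm x \<ge> 8 \<Longrightarrow>
       norm (bernoulli_defect M w x) \<le> K * norm x powr (Re w - real M - 2)"
proof -
  define B where "B = (\<Sum>j\<le>M. norm (bernoulli j))"
  define K where "K = 2 ^ W * exp (pi * real W) * B * 4 ^ (M + 2)"
  have B: "B \<ge> 0" by (simp add: B_def sum_nonneg)
  have bound: "norm (bernoulli_defect M w x) \<le> 2 * K * norm x powr (Re w - real M - 2)"
    if w: "norm w \<le> real W" and x: "Re x > 0" "norm x \<ge> 8" for w x
  proof -
    define f where "f = (\<lambda>n. (w gchoose n) * (\<Sum>j\<le>M. of_nat (n choose j) * bernoulli j) * x powr (w - of_nat n))"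
    define X where "X = norm x powr (Re w - real M - 2)"
    from x have x1: "norm x > 1" "x \<noteq> 0" by auto
    have "(\<lambda>n. if n \<le> M + 1 then 0 else f n) sums bernoulli_defect M w x"
      unfolding f_def by (rule bernoulli_defect_sums[OF x(1) x1(1)])
    then have sums: "(\<lambda>i. f (i + (M + 2))) sums bernoulli_defect M w x"
      using sums_iff_shift[of "\<lambda>n. if n \<le> M + 1 then 0 else f n" "M + 2"] by simp
    have le: "norm (f (i + (M + 2))) \<le> K * X * (1 / 2) ^ i" for i
    proof -
      define n where "n = i + (M + 2)"
      have "norm (\<Sum>j\<le>M. of_nat (n choose j) * bernoulli j) \<le> (\<Sum>j\<le>M. 2 ^ n * norm (bernoulli j))"
        using binomial_le_pow2[of n]
        by (intro sum_norm_le) (auto simp: norm_mult intro!: mult_right_mono simp flip: of_nat_power)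
      then have 1: "norm (\<Sum>j\<le>M. of_nat (n choose j) * bernoulli j) \<le> 2 ^ n * B"
        by (simp add: B_def sum_distrib_left)
      have "norm (x powr (w - of_nat n)) = norm (x powr w) / norm x ^ n"
        using x1 by (simp add: powr_diff powr_nat norm_divide norm_power)
      also have "\<dots> \<le> norm x powr Re w * exp (pi * real W) / norm x ^ n"
      proof -
        have "norm x powr Re w * exp (pi * norm w) \<le> norm x powr Re w * exp (pi * real W)"
          using w by (intro mult_left_mono) auto
        with norm_powr_le[of x w] show ?thesis by (intro divide_right_mono) auto
      qed
      also have "norm x powr Re w = X * norm x ^ (M + 2)"
        unfolding X_def using x1 by (subst powr_realpow[symmetric]) (simp_all add: powr_add[symmetric] algebra_simps)
      also have "X * norm x ^ (M + 2) * exp (pi * real W) / norm x ^ n = X * exp (pi * real W) * (1 / norm x) ^ i"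
        using x1 by (simp add: n_def power_add field_simps)
      also have "\<dots> \<le> X * exp (pi * real W) * (1 / 8) ^ i"
        using x by (intro mult_left_mono power_mono frac_le) (auto simp: X_def)
      finally have 2: "norm (x powr (w - of_nat n)) \<le> X * exp (pi * real W) * (1 / 8) ^ i" .
      have "norm (f n) \<le> 2 ^ (W + n) * (2 ^ n * B) * (X * exp (pi * real W) * (1 / 8) ^ i)"
        unfolding f_def norm_mult
        using norm_gbinomial_le[OF w, of n] 1 2 B by (intro mult_mono) auto
      also have "\<dots> = 2 ^ W * exp (pi * real W) * B * X * ((2 * 2) ^ n * (1 / 8) ^ i)"
        by (simp only: power_mult_distrib power_add mult_ac)
      also have "(2 * 2) ^ n * (1 / 8) ^ i = (4 ^ (M + 2) * (4 * (1 / 8)) ^ i :: real)"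
        by (simp only: power_mult_distrib n_def power_add mult_ac) (simp add: field_simps flip: power_mult_distrib)
      finally show ?thesis by (simp add: K_def n_def mult_ac)
    qed
    have "(\<lambda>i. K * X * (1 / 2) ^ i) sums (K * X * 2)"
      using sums_mult[OF geometric_sums[of "1 / 2 :: real"], of "K * X"] by simp
    then have "norm (bernoulli_defect M w x) \<le> K * X * 2"
      using norm_suminf_le[of "\<lambda>i. f (i + (M + 2))", OF le] sums by (simp add: sums_iff)
    then show ?thesis by (simp add: X_def mult_ac)
  qed
  show thesis
  \<comment> \<open>The added 1 yields strict positivity from \<open>B\<close> being merely
    nonnegative.\<close>
  proof (rule that[of "2 * K + 1"])
    show "2 * K + 1 > 0" using B by (simp add: K_def add_nonneg_pos)
    fix w x :: complex
    assume "norm w \<le> real W" "Re x > 0" "norm x \<ge> 8"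
    from bound[OF this] show "norm (bernoulli_defect M w x) \<le> (2 * K + 1) * norm x powr (Re w - real M - 2)"
      by (rule order_trans) (intro mult_right_mono, auto)
  qed
qed

text \<open>This is the classical Bernoulli polynomial. The point x = 0 is excluded because
  \<open>0 powr 0\<close> is 0, whereas the term j = m needs \<open>0 ^ 0 = 1\<close>.\<close>

lemma bernoulli_powr_of_nat:
  assumes "m \<le> M" "x \<noteq> 0"
  shows "bernoulli_powr M (of_nat m) x = (\<Sum>j\<le>m. of_nat (m choose j) * bernoulli j * x ^ (m - j))"
  unfolding bernoulli_powr_def
proof (rule sum.mono_neutral_cong_right)
  show "\<forall>j\<in>{..M} - {..m}. (of_nat m gchoose j) * bernoulli j * x powr (of_nat m - of_nat j) = 0"
    by (auto simp: binomial_eq_0 simp flip: binomial_gbinomial)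
  fix j assume "j \<in> {..m}"
  then have "x powr (of_nat m - of_nat j) = x ^ (m - j)"
    using assms(2) by (metis atMost_iff of_nat_diff powr_complexpow)
  then show "(of_nat m gchoose j) * bernoulli j * x powr (of_nat m - of_nat j) =
      of_nat (m choose j) * bernoulli j * x ^ (m - j)"
    by (simp add: binomial_gbinomial)
qed (use assms in auto)

text \<open>Every term of the defect series has n > m, where (m choose n) = 0. The series requires
  Re x > 0 and |x| > 1; since the defect is a polynomial in x for w = m, analytic continuation
  removes this restriction.\<close>

lemma bernoulli_defect_of_nat:
  assumes "0 < m" "m \<le> M" "x \<noteq> 0" "x + 1 \<noteq> 0"
  shows "bernoulli_defect M (of_nat m) x = 0"
proof -
  define p :: "complex \<Rightarrow> complex" where "p = (\<lambda>x. (\<Sum>j\<le>m. of_nat (m choose j) * bernoulli j * (x + 1) ^ (m - j))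
       - (\<Sum>j\<le>m. of_nat (m choose j) * bernoulli j * x ^ (m - j)) - of_nat m * x ^ (m - 1))"
  have eq: "bernoulli_defect M (of_nat m) x = p x" if "x \<noteq> 0" "x + 1 \<noteq> 0" for x
  proof -
    have "x powr (of_nat m - 1) = x ^ (m - 1)"
      using that assms(1) by (metis Suc_leI of_nat_1 of_nat_diff powr_complexpow One_nat_def)
    then show ?thesis
      using that assms(2) by (simp add: bernoulli_defect_def p_def bernoulli_powr_of_nat)
  qed
  have "p x = 0"
  proof (rule analytic_continuation_open[of "{x. Re x > 1}" UNIV p "\<lambda>_. 0"])
    show "open {x. Re x > 1}" by (rule open_halfspace_Re_gt)
    show "{x. Re x > 1} \<noteq> {}" by (auto intro!: exI[of _ 2])
    show "p holomorphic_on UNIV" unfolding p_def by (intro holomorphic_intros)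
    fix x :: complex assume x: "x \<in> {x. Re x > 1}"
    then have x': "Re x > 0" "norm x > 1" "x \<noteq> 0" "x + 1 \<noteq> 0"
      using complex_Re_le_cmod[of x] by (auto simp: complex_eq_iff)
    have "(\<lambda>n. 0) sums bernoulli_defect M (of_nat m) x"
      using bernoulli_defect_sums[OF x'(1,2), of M "of_nat m"] assms(2)
      by (auto simp: binomial_eq_0 cong: if_cong simp flip: binomial_gbinomial)
    then show "p x = 0" using eq x' by (simp add: sums_iff)
  qed auto
  with eq assms show ?thesis by simp
qed

lemma holomorphic_on_gbinomial [holomorphic_intros]:
  "f holomorphic_on A \<Longrightarrow> (\<lambda>w. f w gchoose n) holomorphic_on A"
  unfolding gbinomial_prod_rev by (intro holomorphic_intros) auto

lemma holomorphic_bernoulli_powr [holomorphic_intros]: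
  "(\<lambda>w. bernoulli_powr M w x) holomorphic_on A"
  unfolding bernoulli_powr_def by (intro holomorphic_intros)

lemma holomorphic_bernoulli_defect [holomorphic_intros]:
  "(\<lambda>w. bernoulli_defect M w x) holomorphic_on A"
  unfolding bernoulli_defect_def by (intro holomorphic_intros)

section \<open>Series with subpolynomial coefficients\<close>

text \<open>One condition serves both coefficient sequences, 1 and the logarithmically growing
  H_n(a). Losing n^delta for arbitrarily small delta costs nothing in open half planes.\<close>

definition subpolynomial :: "(nat \<Rightarrow> complex) \<Rightarrow> bool" where
  "subpolynomial c \<longleftrightarrow> (\<forall>\<delta>>0. (\<lambda>n. norm (c n)) \<in> O(\<lambda>n. real n powr \<delta>))"

lemma subpolynomial_const: "subpolynomial (\<lambda>_. c)"
  unfolding subpolynomial_def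
proof safe
  fix \<delta> :: real assume "\<delta> > 0"
  then show "(\<lambda>_. norm c) \<in> O(\<lambda>n. real n powr \<delta>)" by real_asymp
qed

lemma of_nat_plus_neq_0: "a \<notin> \<int>\<^sub>\<le>\<^sub>0 \<Longrightarrow> of_nat n + a \<noteq> 0"
  using plus_of_nat_eq_0_imp[of a n] by (auto simp: add.commute)

lemma of_nat_plus_over_of_nat_LIMSEQ: "(\<lambda>n. (of_nat n + a) / of_nat n :: complex) \<longlonglongrightarrow> 1"
proof -
  have "(\<lambda>n. 1 + a / of_nat n) \<longlonglongrightarrow> 1 + 0"
    by (intro tendsto_intros lim_const_over_n)
  then have "(\<lambda>n. 1 + a / of_nat n) \<longlonglongrightarrow> 1" by simp
  then show ?thesis
    by (rule Lim_transform_eventually)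
      (auto intro!: eventually_mono[OF eventually_gt_at_top[of 0]] simp: field_simps)
qed

lemma norm_of_nat_plus_bigtheta: "(\<lambda>n. norm (of_nat n + a :: complex)) \<in> \<Theta>(\<lambda>n. real n)"
proof -
  have "(\<lambda>n. norm ((of_nat n + a) / of_nat n)) \<longlonglongrightarrow> norm (1 :: complex)"
    by (intro tendsto_norm of_nat_plus_over_of_nat_LIMSEQ)
  then have "(\<lambda>n. norm (of_nat n + a :: complex)) \<sim>[at_top] (\<lambda>n. real n)"
    by (intro asymp_equivI') (simp add: norm_divide)
  then show ?thesis by (rule asymp_equiv_imp_bigtheta)
qed

lemma subpolynomial_times_powr_bigo:
  fixes a :: complex
  assumes "subpolynomial c" "\<delta> > 0"
  shows "(\<lambda>n. norm (c n) * norm (of_nat n + a) powr r) \<in> O(\<lambda>n. real n powr (r + \<delta>))"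
proof -
  have "(\<lambda>n. \<bar>norm (of_nat n + a)\<bar> powr r) \<in> \<Theta>(\<lambda>n. \<bar>real n\<bar> powr r)"
    by (intro bigtheta_powr norm_of_nat_plus_bigtheta)
  then have "(\<lambda>n. norm (of_nat n + a) powr r) \<in> O(\<lambda>n. real n powr r)"
    by (simp add: bigthetaD1)
  with assms have "(\<lambda>n. norm (c n) * norm (of_nat n + a) powr r) \<in> O(\<lambda>n. real n powr \<delta> * real n powr r)"
    unfolding subpolynomial_def by (intro landau_o.big_mult) auto
  then show ?thesis by (simp add: powr_add mult.commute)
qed

lemma summable_subpolynomial_powr:
  fixes a :: complex
  assumes "subpolynomial c" "r < -1"
  shows "summable (\<lambda>n. norm (c n) * norm (of_nat n + a) powr r)"
proof (rule summable_comparison_test_bigo)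
  \<comment> \<open>Half of the gap between r and -1 is spent on the growth of c, which leaves a
    total exponent still below -1.\<close>
  show "(\<lambda>n. norm (c n) * norm (of_nat n + a) powr r) \<in> O(\<lambda>n. real n powr (r + (- 1 - r) / 2))"
    using assms by (intro subpolynomial_times_powr_bigo) auto
  show "summable (\<lambda>n. norm (real n powr (r + (- 1 - r) / 2)))"
    using assms(2) by (simp add: summable_real_powr_iff field_simps)
qed

lemma summable_subpolynomial_powr_complex:
  assumes "subpolynomial c" "Re v < -1"
  shows "summable (\<lambda>n. c n * (of_nat n + a) powr v)"
proof (rule summable_comparison_test)
  show "\<exists>N. \<forall>n\<ge>N. norm (c n * (of_nat n + a) powr v) \<le>
      norm (c n) * norm (of_nat n + a) powr Re v * exp (pi * norm v)"
    using norm_powr_le[of _ v] by (auto simp: norm_mult mult.assoc intro!: mult_left_mono)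
  show "summable (\<lambda>n. norm (c n) * norm (of_nat n + a) powr Re v * exp (pi * norm v))"
    by (intro summable_mult2 summable_subpolynomial_powr assms)
qed

lemma subpolynomial_powr_LIMSEQ:
  assumes "subpolynomial c" "Re v < 0"
  shows "(\<lambda>n. c n * (of_nat n + a) powr v) \<longlonglongrightarrow> 0"
proof -
  define r where "r = Re v"
  have "(\<lambda>n. norm (c n) * norm (of_nat n + a) powr r) \<in> O(\<lambda>n. real n powr (r + (- r) / 2))"
    using assms by (intro subpolynomial_times_powr_bigo) (auto simp: r_def)
  also have "(\<lambda>n. real n powr (r + (- r) / 2)) \<in> o(\<lambda>_. 1)"
    using assms(2) unfolding r_def[symmetric] by real_asymp
  finally have "(\<lambda>n. norm (c n) * norm (of_nat n + a) powr r) \<longlonglongrightarrow> 0"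
    using smalloD_tendsto by fastforce
  from tendsto_mult_left_zero[OF this, of "exp (pi * norm v)"]
  have lim: "(\<lambda>n. norm (c n) * norm (of_nat n + a) powr r * exp (pi * norm v)) \<longlonglongrightarrow> 0" .
  show ?thesis
  proof (rule Lim_null_comparison[OF always_eventually lim], rule allI)
    fix n
    show "norm (c n * (of_nat n + a) powr v) \<le> norm (c n) * norm (of_nat n + a) powr r * exp (pi * norm v)"
      using norm_powr_le[of _ v] by (auto simp: norm_mult mult.assoc r_def intro!: mult_left_mono)
  qed
qed

lemma subpolynomial_bernoulli_powr_LIMSEQ:
  assumes "subpolynomial c" "Re w < 0"
  shows "(\<lambda>n. c n * bernoulli_powr M w (of_nat n + a)) \<longlonglongrightarrow> 0"
proof -
  have "(\<lambda>n. \<Sum>j\<le>M. (w gchoose j) * bernoulli j * (c n * (of_nat n + a) powr (w - of_nat j)))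
      \<longlonglongrightarrow> (\<Sum>j\<le>M. (w gchoose j) * bernoulli j * 0)"
    using assms by (intro tendsto_intros subpolynomial_powr_LIMSEQ) auto
  then show ?thesis
    by (simp add: bernoulli_powr_def sum_distrib_left mult_ac)
qed

text \<open>The defect decays like |n + a|^(Re w - M - 2), uniformly for w near a given point, so
  the terms are dominated by a convergent series and may be differentiated one by one. The
  derivative series is needed to find the constant term of zeta(s,a) at s = 1.\<close>

lemma defect_series_sums:
  assumes c: "subpolynomial c"
  shows "Re w < real M + 1 \<Longrightarrow>
           summable (\<lambda>n. c n * bernoulli_defect M w (of_nat n + a))" (is "_ \<Longrightarrow> ?A")
    and "(\<lambda>w. \<Sum>n. c n * bernoulli_defect M w (of_nat n + a)) holomorphic_on {w. Re w < real M + 1}" (is ?B)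
    and "Re w < real M + 1 \<Longrightarrow>
           (\<lambda>n. c n * deriv (\<lambda>w. bernoulli_defect M w (of_nat n + a)) w) sums
           deriv (\<lambda>w. \<Sum>n. c n * bernoulli_defect M w (of_nat n + a)) w" (is "_ \<Longrightarrow> ?C")
proof -
  define S where "S = {w. Re w < real M + 1}"
  define f where "f = (\<lambda>n w. c n * bernoulli_defect M w (of_nat n + a))"
  define f' where "f' = (\<lambda>n w. c n * deriv (\<lambda>w. bernoulli_defect M w (of_nat n + a)) w)"
  have S: "open S" unfolding S_def by (rule open_halfspace_Re_lt)
  have f': "(f n has_field_derivative f' n w) (at w)" for n w
  proof -
    have "(\<lambda>w. bernoulli_defect M w (of_nat n + a)) holomorphic_on UNIV"
      by (intro holomorphic_intros)
    then show ?thesis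
      unfolding f_def f'_def
      by (intro DERIV_cmult holomorphic_derivI[of _ UNIV]) auto
  qed
  have "\<exists>g g'. \<forall>w\<in>S. ((\<lambda>n. f n w) sums g w) \<and> ((\<lambda>n. f' n w) sums g' w) \<and> (g has_field_derivative g' w) (at w)"
  proof (rule series_and_derivative_comparison_complex[OF S f'])
    fix w assume w: "w \<in> S"
    \<comment> \<open>Half the distance to the boundary line: on the ball of radius d the exponent
      is at most -1 - d.\<close>
    define d where "d = (real M + 1 - Re w) / 2"
    have d: "d > 0" using w by (simp add: d_def S_def)
    define W where "W = nat \<lceil>norm w + d\<rceil>"
    obtain K where K: "K > 0" "\<And>w x. norm w \<le> real W \<Longrightarrow> Re x > 0 \<Longrightarrow> norm x \<ge> 8 \<Longrightarrow>
       norm (bernoulli_defect M w x) \<le> K * norm x powr (Re w - real M - 2)"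
      using norm_bernoulli_defect_le by blast
    define h where "h = (\<lambda>n. norm (c n) * norm (of_nat n + a) powr (Re w + d - real M - 2) * K)"
    have "summable h"
      unfolding h_def using d
      by (intro summable_mult2 summable_subpolynomial_powr c) (simp add: d_def field_simps)
    moreover have "\<forall>\<^sub>F n in sequentially. \<forall>y\<in>ball w d \<inter> S. norm (f n y) \<le> norm (complex_of_real (h n))"
      using eventually_ge_at_top[of "nat \<lceil>norm a\<rceil> + 9"]
    proof eventually_elim
      case (elim n)
      define x where "x = of_nat n + a"
      \<comment> \<open>From this index on Re (n + a) >= 9, which meets both requirements on x in
        the defect bound.\<close>
      have n: "real n \<ge> norm a + 9" using elim by linarith
      have Re: "Re x \<ge> 9"
        using n abs_Re_le_cmod[of a] by (simp add: x_def)
      then have x: "norm x \<ge> 9" using complex_Re_le_cmod[of x] by linarith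
      show ?case
      proof
        fix y assume y: "y \<in> ball w d \<inter> S"
        then have yw: "norm (y - w) < d" by (simp add: dist_norm norm_minus_commute)
        have "norm y \<le> norm w + norm (y - w)" by (metis add_diff_cancel_left' diff_add_cancel norm_triangle_ineq add.commute)
        then have yW: "norm y \<le> real W" using yw unfolding W_def by linarith
        have "Re y \<le> Re w + d" using yw complex_Re_le_cmod[of "y - w"] by simp
        then have "norm x powr (Re y - real M - 2) \<le> norm x powr (Re w + d - real M - 2)"
          using x by (intro powr_mono) auto
        with K(2)[OF yW, of x] Re x K(1) have "norm (bernoulli_defect M y x) \<le> norm x powr (Re w + d - real M - 2) * K"
          by (smt (verit) mult.commute mult_left_mono)
        then have "norm (f n y) \<le> h n"
          unfolding f_def h_def norm_mult x_def[symmetric] mult.assoc by (intro mult_left_mono) auto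
        then show "norm (f n y) \<le> norm (complex_of_real (h n))" by simp
      qed
    qed
    ultimately show "\<exists>d h. 0 < d \<and> summable h \<and> range h \<subseteq> \<real>\<^sub>\<ge>\<^sub>0 \<and>
        (\<forall>\<^sub>F n in sequentially. \<forall>y\<in>ball w d \<inter> S. norm (f n y) \<le> cmod (h n))"
      using d by (intro exI[of _ d] exI[of _ "\<lambda>n. complex_of_real (h n)"] conjI summable_of_real)
        (use K(1) in \<open>auto simp: h_def simp del: of_real_mult\<close>)
  qed
  then obtain g g' where g: "\<And>w. w \<in> S \<Longrightarrow> (\<lambda>n. f n w) sums g w"
    "\<And>w. w \<in> S \<Longrightarrow> (\<lambda>n. f' n w) sums g' w" "\<And>w. w \<in> S \<Longrightarrow> (g has_field_derivative g' w) (at w)"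
    by blast
  define F where "F = (\<lambda>w. \<Sum>n. f n w)"
  have Fg: "F w = g w" if "w \<in> S" for w
    using g(1)[OF that] by (simp add: F_def sums_iff)
  have F: "(F has_field_derivative g' w) (at w)" if "w \<in> S" for w
    using g(3)[OF that] S that by (rule has_field_derivative_transform_within_open) (simp add: Fg)
  have "summable (\<lambda>n. f n w)" if "w \<in> S" for w
    using g(1)[OF that] by (simp add: sums_iff)
  then show "Re w < real M + 1 \<Longrightarrow> ?A"
    by (simp add: S_def f_def)
  have "F holomorphic_on S"
    using F S holomorphic_on_open by blast
  then show ?B by (simp add: F_def f_def S_def)
  have "(\<lambda>n. f' n w) sums deriv F w" if "w \<in> S" for w
    using g(2)[OF that] DERIV_imp_deriv[OF F[OF that]] by simp
  then show "Re w < real M + 1 \<Longrightarrow> ?C"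
    by (simp add: F_def f_def f'_def S_def)
qed

text \<open>Telescope c(n) b(n) with b(n) = B_w(n+a), and replace b(n+1) - b(n) by the defect plus w
  (n+a)^(w-1). For Re w < 0 the products c(n) b(n) tend to 0 and the last series converges.\<close>

lemma bernoulli_powr_summation_by_parts:
  assumes c: "subpolynomial c" and w: "Re w < 0"
  shows "(\<lambda>n. (c (Suc n) - c n) * bernoulli_powr M w (of_nat (Suc n) + a)) sums
           - (c 0 * bernoulli_powr M w a
              + (\<Sum>n. c n * bernoulli_defect M w (of_nat n + a))
              + w * (\<Sum>n. c n * (of_nat n + a) powr (w - 1)))"
proof -
  define b where "b = (\<lambda>n. bernoulli_powr M w (of_nat n + a))"
  have "(\<lambda>n. c (Suc n) * b (Suc n) - c n * b n) sums (0 - c 0 * b 0)"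
    unfolding b_def by (rule telescope_sums, rule subpolynomial_bernoulli_powr_LIMSEQ[OF c w])
  moreover have "(\<lambda>n. c n * bernoulli_defect M w (of_nat n + a)) sums
      (\<Sum>n. c n * bernoulli_defect M w (of_nat n + a))"
    using defect_series_sums(1)[OF c] w by (intro summable_sums) auto
  moreover have "(\<lambda>n. w * (c n * (of_nat n + a) powr (w - 1))) sums
      (w * (\<Sum>n. c n * (of_nat n + a) powr (w - 1)))"
    using w by (intro sums_mult summable_sums summable_subpolynomial_powr_complex c) auto
  ultimately have "(\<lambda>n. c (Suc n) * b (Suc n) - c n * b n
        - (c n * bernoulli_defect M w (of_nat n + a) + w * (c n * (of_nat n + a) powr (w - 1)))) sums
      (0 - c 0 * b 0 - ((\<Sum>n. c n * bernoulli_defect M w (of_nat n + a)) + w * (\<Sum>n. c n * (of_nat n + a) powr (w - 1))))"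
    by (rule sums_diff[OF _ sums_add])
  then show ?thesis
    by (simp add: bernoulli_defect_def b_def algebra_simps)
qed

text \<open>The limit formula for psi(a) says that ln m minus the partial harmonic sum converges, so
  H_n(a) is at most ln(n+1) plus a constant.\<close>

lemma shifted_harm_subpolynomial:
  assumes "a \<notin> \<int>\<^sub>\<le>\<^sub>0"
  shows "subpolynomial (\<lambda>n. shifted_harm n a)"
proof -
  have "a \<noteq> 0" using assms by auto
  have "(\<lambda>m. of_real (ln (real m)) - (\<Sum>n<m. inverse (a + of_nat n))) \<longlonglongrightarrow> Digamma a"
    using \<open>a \<noteq> 0\<close> by (rule Digamma_LIMSEQ)
  then have "Bseq (\<lambda>m. of_real (ln (real m)) - (\<Sum>n<m. inverse (a + of_nat n)))"
    by (rule convergent_imp_Bseq[OF convergentI])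
  then obtain C where C: "\<And>m. norm (of_real (ln (real m)) - (\<Sum>n<m. inverse (a + of_nat n))) \<le> C"
    unfolding Bseq_def by blast
  have le: "norm (shifted_harm n a) \<le> ln (real n + 1) + C" for n
  proof -
    have "shifted_harm n a = (\<Sum>n<Suc n. inverse (a + of_nat n))"
      unfolding shifted_harm_def
      by (intro sum.cong) (auto simp: inverse_eq_divide add.commute)
    then have "norm (shifted_harm n a) \<le> norm (of_real (ln (real (Suc n))) :: complex) + C"
      using C[of "Suc n"] norm_triangle_ineq4[of "of_real (ln (real (Suc n)))" "of_real (ln (real (Suc n))) - shifted_harm n a"]
      by simp
    then show ?thesis by (simp add: add.commute)
  qed
  show ?thesis
    unfolding subpolynomial_def
  proof safe
    fix \<delta> :: real assume \<delta>: "\<delta> > 0"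
    have "(\<lambda>n. norm (shifted_harm n a)) \<in> O(\<lambda>n. ln (real n + 1) + C)"
      using le by (intro landau_o.big_mono always_eventually) (auto intro: order_trans[OF _ abs_ge_self])
    also have "(\<lambda>n. ln (real n + 1) + C) \<in> O(\<lambda>n. real n powr \<delta>)"
      using \<delta> by real_asymp
    finally show "(\<lambda>n. norm (shifted_harm n a)) \<in> O(\<lambda>n. real n powr \<delta>)" .
  qed
qed

section \<open>Meromorphic continuation from half planes\<close>

lemma remove_sings_nicely_meromorphic_eq:
  assumes "f nicely_meromorphic_on A" "z \<in> A"
  shows "remove_sings f z = f z"
  using assms unfolding nicely_meromorphic_on_def by (metis remove_sings_at_pole remove_sings_eqI)

lemma nicely_meromorphic_on_eqI_at:
  assumes "f nicely_meromorphic_on A" "g nicely_meromorphic_on A" "z \<in> A"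
    and "\<forall>\<^sub>F w in at z. f w = g w"
  shows "f z = g z"
  using remove_sings_cong[OF assms(4) refl] assms(1-3)
  by (simp add: remove_sings_nicely_meromorphic_eq)

text \<open>After the identity theorem is applied to the difference, agreement extends even to
  poles, because the value of a nicely meromorphic function is determined by its punctured
  germ.\<close>

lemma nicely_meromorphic_on_eqI_connected:
  assumes f: "f nicely_meromorphic_on A" and g: "g nicely_meromorphic_on A"
    and A: "open A" "connected A" and u: "u \<in> A" "\<forall>\<^sub>F w in at u. f w = g w" and z: "z \<in> A"
  shows "f z = g z"
proof -
  define h where "h = remove_sings (\<lambda>s. f s - g s)"
  have mero: "(\<lambda>s. f s - g s) meromorphic_on A"
    using f g unfolding nicely_meromorphic_on_def by (intro meromorphic_intros) auto
  have h: "h nicely_meromorphic_on A"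
    unfolding h_def by (rule remove_sings_nicely_meromorphic[OF mero])
  have near: "\<forall>\<^sub>F w in at w0. h w = f w - g w" if "w0 \<in> A" for w0
    unfolding h_def using that mero
    by (intro eventually_remove_sings_eq_at meromorphic_on_isolated_singularity[OF meromorphic_on_subset[OF mero]]) auto
  have "\<forall>\<^sub>F w in at u. h w = 0"
    using near[OF u(1)] u(2) by eventually_elim simp
  then have "\<exists>\<^sub>F w in at u. h w = 0"
    by (intro eventually_frequently) auto
  then have h0: "h w = 0" if "w \<in> A" for w
    using frequently_eq_meromorphic_imp_constant[OF _ h A u(1) that] by blast
  have "\<forall>\<^sub>F w in at z. w \<in> A"
    using A(1) z by (rule eventually_at_in_open')
  then have "\<forall>\<^sub>F w in at z. f w = g w"
    using near[OF z] by eventually_elim (simp add: h0)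
  with nicely_meromorphic_on_eqI_at[OF f g z] show ?thesis by simp
qed

text \<open>Once normalised by \<open>remove_sings\<close>, the functions g N agree pointwise on
  nested half planes and glue to one function. The normalisation may change values at singular
  points, hence a punctured equality in general and a pointwise one only where g N is
  analytic.\<close>

lemma meromorphic_continuation_half_planes:
  fixes g :: "nat \<Rightarrow> complex \<Rightarrow> complex"
  assumes mero: "\<And>N. g N meromorphic_on {s. Re s > - real N}"
    and hol: "f holomorphic_on {s. Re s > 1}"
    and eq: "\<And>N s. Re s > 1 \<Longrightarrow> g N s = f s"
  defines "F \<equiv> meromorphic_continuation {s. Re s > 1} f"
  shows "F nicely_meromorphic_on UNIV"
    and "Re s > 1 \<Longrightarrow> F s = f s"
    and "Re z > - real N \<Longrightarrow> \<forall>\<^sub>F s in at z. F s = g N s"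
    and "Re z > - real N \<Longrightarrow> g N analytic_on {z} \<Longrightarrow> F z = g N z"
proof -
  define H where "H = (\<lambda>N. {s. Re s > - real N})"
  define h where "h = (\<lambda>N. remove_sings (g N))"
  \<comment> \<open>Any index exceeding -Re s would do; the added 1 makes the inequality
    strict.\<close>
  define G where "G = (\<lambda>s. h (nat \<lceil>- Re s\<rceil> + 1) s)"
  have open_H: "open (H N)" for N
    unfolding H_def by (rule open_halfspace_Re_gt)
  have near_H: "\<forall>\<^sub>F w in at z. w \<in> H N" if "z \<in> H N" for z N
    using open_H that by (rule eventually_at_in_open')
  have h: "h N nicely_meromorphic_on H N" for N
    unfolding h_def H_def by (rule remove_sings_nicely_meromorphic[OF mero])
  have op: "open {s. Re s > 1}" by (rule open_halfspace_Re_gt)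
  have h_f: "h N s = f s" if "Re s > 1" for N s
  proof -
    have "f analytic_on {s}"
      using hol that analytic_at op by blast
    moreover have "\<forall>\<^sub>F w in nhds s. g N w = f w"
      using eventually_nhds_in_open[OF op, of s] that by (auto elim!: eventually_mono simp: eq)
    ultimately have "g N analytic_on {s}"
      using analytic_at_cong by blast
    then show ?thesis using eq that by (simp add: h_def)
  qed
  have h_mono: "h N s = h N' s" if "N \<le> N'" "s \<in> H N" for N N' s
  proof (rule nicely_meromorphic_on_eqI_connected[where f = "h N" and g = "h N'" and A = "H N" and u = 2])
    show "h N' nicely_meromorphic_on H N"
      using h[of N'] by (rule nicely_meromorphic_on_subset) (use that in \<open>auto simp: H_def\<close>)
    show "connected (H N)"
      unfolding H_def by (intro convex_connected convex_halfspace_Re_gt)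
    have "\<forall>\<^sub>F w in at 2. w \<in> {s. Re s > 1}"
      using op by (rule eventually_at_in_open') auto
    then show "\<forall>\<^sub>F w in at 2. h N w = h N' w"
      by eventually_elim (simp add: h_f)
  qed (use that open_H h in \<open>auto simp: H_def\<close>)
  have index: "s \<in> H (nat \<lceil>- Re s\<rceil> + 1)" for s
    unfolding H_def by simp linarith
  have G_h: "G s = h N s" if "s \<in> H N" for N s
    using h_mono[of N _ s] h_mono[of _ N s] that index[of s] unfolding G_def
    by (metis nle_le)
  have G_near: "\<forall>\<^sub>F w in at z. G w = h N w" if "z \<in> H N" for z N
    using near_H[OF that] by eventually_elim (rule G_h)
  have "G nicely_meromorphic_on H N" for N
  proof -
    have "G meromorphic_on H N"
      using h meromorphic_on_cong[OF G_near refl, of "H N" N] by (simp add: nicely_meromorphic_on_def)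
    moreover have "is_pole G z \<and> G z = 0 \<or> G \<midarrow>z\<rightarrow> G z" if "z \<in> H N" for z
      using h[of N] that is_pole_cong[OF G_near[OF that] refl] tendsto_cong[OF G_near[OF that]] G_h[OF that]
      unfolding nicely_meromorphic_on_def by auto
    ultimately show ?thesis by (simp add: nicely_meromorphic_on_def)
  qed
  then have G: "G nicely_meromorphic_on UNIV"
    using index unfolding nicely_meromorphic_on_def meromorphic_on_def by blast
  have FG: "F = G"
    unfolding F_def
  proof (rule meromorphic_continuation_eqI[OF G op])
    show "{s. Re s > 1} \<noteq> {}" by (auto intro!: exI[of _ 2])
    show "G s = f s" if "s \<in> {s. Re s > 1}" for s
      using that by (simp add: G_def h_f)
  qed
  show "F nicely_meromorphic_on UNIV" using G FG by simp
  show "F s = f s" if "Re s > 1"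
    using that by (simp add: FG G_def h_f)
  show "\<forall>\<^sub>F s in at z. F s = g N s" if "Re z > - real N"
  proof -
    have z: "z \<in> H N" using that by (simp add: H_def)
    have "isolated_singularity_at (g N) z"
      using mero[of N] that
      by (intro meromorphic_on_isolated_singularity[OF meromorphic_on_subset[of _ "{s. Re s > - real N}"]]) auto
    then have "\<forall>\<^sub>F w in at z. h N w = g N w"
      unfolding h_def by (rule eventually_remove_sings_eq_at)
    with G_near[OF z] show ?thesis
      unfolding FG by eventually_elim simp
  qed
  show "F z = g N z" if "Re z > - real N" "g N analytic_on {z}"
    using that G_h[of z N] by (simp add: FG H_def h_def)
qed

section \<open>The Hurwitz zeta function\<close>

definition hurwitz_numerator :: "nat \<Rightarrow> complex \<Rightarrow> complex \<Rightarrow> complex" where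
  "hurwitz_numerator M a w = bernoulli_powr M w a + (\<Sum>n. bernoulli_defect M w (of_nat n + a))"

lemma hurwitz_numerator_holomorphic: "hurwitz_numerator M a holomorphic_on {w. Re w < real M + 1}"
proof -
  have "(\<lambda>w. \<Sum>n. bernoulli_defect M w (of_nat n + a)) holomorphic_on {w. Re w < real M + 1}"
    using defect_series_sums(2)[OF subpolynomial_const[of 1]] by simp
  then show ?thesis
    unfolding hurwitz_numerator_def by (intro holomorphic_intros)
qed

lemma hurwitz_numerator_analytic: "hurwitz_numerator M a analytic_on {w. Re w < real M + 1}"
  using hurwitz_numerator_holomorphic by (simp add: analytic_on_open open_halfspace_Re_lt)

lemma hurwitz_numerator_analytic' [analytic_intros]:
  assumes "f analytic_on A" "\<And>s. s \<in> A \<Longrightarrow> Re (f s) < real M + 1"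
  shows "(\<lambda>s. hurwitz_numerator M a (f s)) analytic_on A"
  using analytic_on_compose_gen[OF assms(1) hurwitz_numerator_analytic] assms(2) by (simp add: o_def)

text \<open>For constant c the increments vanish, so summation by parts reads 0 on the left.\<close>

lemma hurwitz_numerator_eq_suminf:
  assumes "Re w < 0"
  shows "hurwitz_numerator M a w = - w * (\<Sum>n. (of_nat n + a) powr (w - 1))"
proof -
  have "(\<lambda>n. 0 :: complex) sums - (bernoulli_powr M w a + (\<Sum>n. bernoulli_defect M w (of_nat n + a))
          + w * (\<Sum>n. (of_nat n + a) powr (w - 1)))"
    using bernoulli_powr_summation_by_parts[OF subpolynomial_const[of 1] assms, of M a] by simp
  from sums_unique2[OF this sums_zero]
  have "hurwitz_numerator M a w + w * (\<Sum>n. (of_nat n + a) powr (w - 1)) = 0"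
    unfolding hurwitz_numerator_def by (simp only: neg_equal_0_iff_equal)
  then show ?thesis by (simp add: eq_neg_iff_add_eq_0)
qed

lemma
  shows hurwitz_zeta_nicely_meromorphic: "(\<lambda>s. hurwitz_zeta s a) nicely_meromorphic_on UNIV"
    and hurwitz_zeta_eq_suminf: "Re s > 1 \<Longrightarrow> hurwitz_zeta s a = (\<Sum>n. (of_nat n + a) powr (- s))"
    and hurwitz_zeta_eq: "Re s > - real N \<Longrightarrow> s \<noteq> 1 \<Longrightarrow>
      hurwitz_zeta s a = hurwitz_numerator N a (1 - s) / (s - 1)"
proof -
  define g where "g = (\<lambda>N s. hurwitz_numerator N a (1 - s) / (s - 1))"
  define f where "f = (\<lambda>s. \<Sum>n. (of_nat n + a) powr (- s))"
  have eq: "g N s = f s" if "Re s > 1" for N s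
  proof -
    have "s \<noteq> 1" using that by auto
    moreover have "hurwitz_numerator N a (1 - s) = (s - 1) * f s"
      using that hurwitz_numerator_eq_suminf[of "1 - s" N a] by (simp add: f_def)
    ultimately show ?thesis by (simp add: g_def)
  qed
  have ana: "g N analytic_on {s. Re s > - real N} - {1}" for N
    unfolding g_def by (intro analytic_intros) auto
  have "(\<lambda>s. hurwitz_numerator N a (1 - s)) analytic_on {s. Re s > - real N}" for N
    by (intro analytic_intros) auto
  then have mero: "g N meromorphic_on {s. Re s > - real N}" for N
    unfolding g_def by (intro meromorphic_intros analytic_on_imp_meromorphic_on) auto
  \<comment> \<open>Holomorphy of the Dirichlet series is read off from its representation with M =
    0.\<close>
  have "g 0 analytic_on {s. Re s > 1}"
    using ana[of 0] by (rule analytic_on_subset) auto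
  then have "g 0 holomorphic_on {s. Re s > 1}"
    by (rule analytic_imp_holomorphic)
  then have hol: "f holomorphic_on {s. Re s > 1}"
    by (rule holomorphic_transform) (simp add: eq)
  note * = meromorphic_continuation_half_planes[where g = g, OF mero hol eq]
  have F: "meromorphic_continuation {s. Re s > 1} f = (\<lambda>s. hurwitz_zeta s a)"
    by (simp add: hurwitz_zeta_def f_def fun_eq_iff)
  show "(\<lambda>s. hurwitz_zeta s a) nicely_meromorphic_on UNIV"
    using *(1) unfolding F .
  show "hurwitz_zeta s a = (\<Sum>n. (of_nat n + a) powr (- s))" if "Re s > 1"
    using *(2)[of s] that unfolding F by (simp add: f_def)
  show "hurwitz_zeta s a = hurwitz_numerator N a (1 - s) / (s - 1)" if "Re s > - real N" "s \<noteq> 1"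
  proof -
    have "g N analytic_on {s}"
      using ana[of N] by (rule analytic_on_subset) (use that in auto)
    then show ?thesis using *(4)[of N s] that by (simp add: F g_def)
  qed
qed

lemma hurwitz_zeta_analytic [analytic_intros]:
  assumes "f analytic_on A" "\<And>s. s \<in> A \<Longrightarrow> f s \<noteq> 1"
  shows "(\<lambda>s. hurwitz_zeta (f s) a) analytic_on A"
proof -
  have "(\<lambda>s. hurwitz_zeta s a) analytic_on - {1}"
  proof (subst analytic_on_analytic_at, rule ballI)
    fix z :: complex assume "z \<in> - {1}"
    then have z: "z \<noteq> 1" by simp
    define N where "N = nat \<lceil>- Re z\<rceil> + 1"
    define H where "H = {s. Re s > - real N} - {1}"
    have "open H"
      unfolding H_def by (intro open_Diff open_halfspace_Re_gt) auto
    moreover have zH: "z \<in> H"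
      using z unfolding H_def N_def by simp linarith
    ultimately have "\<forall>\<^sub>F s in nhds z. s \<in> H"
      by (rule eventually_nhds_in_open)
    then have ev: "\<forall>\<^sub>F s in nhds z. hurwitz_numerator N a (1 - s) / (s - 1) = hurwitz_zeta s a"
      by eventually_elim (simp add: H_def hurwitz_zeta_eq[of N])
    have "(\<lambda>s. hurwitz_numerator N a (1 - s) / (s - 1)) analytic_on {z}"
      using zH by (intro analytic_intros) (auto simp: H_def)
    then show "(\<lambda>s. hurwitz_zeta s a) analytic_on {z}"
      using analytic_at_cong[OF ev refl] by simp
  qed
  from analytic_on_compose_gen[OF assms(1) this] assms(2) show ?thesis by (simp add: o_def)
qed

section \<open>Residue and constant term of the Hurwitz zeta function at s = 1\<close>

lemma hurwitz_numerator_0: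
  assumes "a \<notin> \<int>\<^sub>\<le>\<^sub>0"
  shows "hurwitz_numerator 0 a 0 = 1"
proof -
  \<comment> \<open>At w = 0 the defect is x^0 differenced, 1 - 1; this uses n + a nonzero, as
    \<open>0 powr 0\<close> is 0.\<close>
  have "bernoulli_defect 0 0 (of_nat n + a) = 0" for n
    using of_nat_plus_neq_0[OF assms, of n] of_nat_plus_neq_0[OF assms, of "Suc n"]
    by (simp add: bernoulli_defect_def bernoulli_powr_def add_ac)
  then show ?thesis
    using of_nat_plus_neq_0[OF assms, of 0]
    by (simp add: hurwitz_numerator_def bernoulli_powr_def bernoulli_0)
qed

lemma Ln_of_nat_plus_LIMSEQ: "(\<lambda>n. Ln (of_nat n + a) - of_real (ln (real n))) \<longlonglongrightarrow> 0"
proof -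
  have "(\<lambda>n. Ln ((of_nat n + a) / of_nat n)) \<longlonglongrightarrow> Ln 1"
    by (intro tendsto_Ln of_nat_plus_over_of_nat_LIMSEQ) auto
  moreover have "\<forall>\<^sub>F n in sequentially.
      Ln ((of_nat n + a) / of_nat n) = Ln (of_nat n + a) - of_real (ln (real n))"
    using eventually_gt_at_top[of "nat \<lceil>norm a\<rceil> + 1"]
  proof eventually_elim
    case (elim n)
    have "real n > norm a" using elim by linarith
    then have "of_nat n + a \<noteq> 0"
      by (metis add_eq_0_iff norm_minus_cancel norm_of_nat order_less_irrefl)
    then show ?case
      using Ln_times_of_real[of "real n" "(of_nat n + a) / of_nat n"] elim by simp
  qed
  ultimately show ?thesis
    using Lim_transform_eventually by fastforce
qed

text \<open>With w = 1 - s this says (s-1) zeta(s,a) = 1 - psi(a)(s-1) + ..., so -psi(a) is the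
  constant term at the pole.\<close>

lemma hurwitz_numerator_has_field_derivative_0:
  assumes "a \<notin> \<int>\<^sub>\<le>\<^sub>0"
  shows "(hurwitz_numerator 0 a has_field_derivative Digamma a) (at 0)"
proof -
  define G where "G = (\<lambda>w. \<Sum>n. bernoulli_defect 0 w (of_nat n + a))"
  define x where "x = (\<lambda>n. of_nat n + a)"
  have x: "x n \<noteq> 0" for n
    using of_nat_plus_neq_0[OF assms] by (simp add: x_def)
  have x1: "x n + 1 = x (Suc n)" for n by (simp add: x_def)
  have powr_deriv: "((\<lambda>w. z powr w) has_field_derivative Ln z) (at 0)" if "z \<noteq> 0" for z :: complex
    using that has_field_derivative_powr_right[of z 0] by simp
  have "((\<lambda>w. bernoulli_defect 0 w (x n)) has_field_derivative (Ln (x (Suc n)) - Ln (x n) - 1 / x n)) (at 0)" for n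
  proof -
    have "((\<lambda>w. w * (x n powr w / x n)) has_field_derivative 1 / x n) (at 0)"
      using x[of n] by (auto intro!: derivative_eq_intros powr_deriv)
    then have "((\<lambda>w. w * x n powr (w - 1)) has_field_derivative 1 / x n) (at 0)"
      using x[of n] by (simp add: powr_diff)
    then show ?thesis
      using x[of n] x[of "Suc n"]
      by (auto simp: bernoulli_defect_def bernoulli_powr_def bernoulli_0 x1 intro!: DERIV_diff powr_deriv)
  qed
  then have "deriv (\<lambda>w. bernoulli_defect 0 w (x n)) 0 = Ln (x (Suc n)) - Ln (x n) - 1 / x n" for n
    by (rule DERIV_imp_deriv)
  then have "(\<lambda>n. Ln (x (Suc n)) - Ln (x n) - 1 / x n) sums deriv G 0"
    using defect_series_sums(3)[OF subpolynomial_const[of 1], of 0 0 a] by (simp add: x_def G_def)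
  then have lim: "(\<lambda>L. \<Sum>n<L. Ln (x (Suc n)) - Ln (x n) - 1 / x n) \<longlonglongrightarrow> deriv G 0"
    by (simp add: sums_def)
  \<comment> \<open>Inserting ln L splits the telescoped sum into two convergent pieces; the
    remaining -Ln a cancels the derivative of \<open>a powr w\<close>.\<close>
  have partial: "(\<Sum>n<L. Ln (x (Suc n)) - Ln (x n) - 1 / x n) =
      (Ln (x L) - of_real (ln (real L))) + (of_real (ln (real L)) - (\<Sum>n<L. inverse (a + of_nat n))) - Ln a" for L
    using sum_lessThan_telescope[of "\<lambda>n. Ln (x n)" L]
    by (simp add: sum_subtractf x_def inverse_eq_divide add.commute)
  have "a \<noteq> 0" using x[of 0] by (simp add: x_def)
  then have "(\<lambda>L. \<Sum>n<L. Ln (x (Suc n)) - Ln (x n) - 1 / x n) \<longlonglongrightarrow> 0 + Digamma a - Ln a"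
    unfolding partial unfolding x_def by (intro tendsto_intros Ln_of_nat_plus_LIMSEQ Digamma_LIMSEQ)
  with lim have "deriv G 0 = Digamma a - Ln a"
    using LIMSEQ_unique by fastforce
  moreover have "(G has_field_derivative deriv G 0) (at 0)"
    using defect_series_sums(2)[OF subpolynomial_const[of 1], of 0 a]
    by (intro holomorphic_derivI[of _ "{w. Re w < 1}"]) (auto simp: G_def open_halfspace_Re_lt)
  ultimately have "((\<lambda>w. a powr w + G w) has_field_derivative Ln a + (Digamma a - Ln a)) (at 0)"
    using \<open>a \<noteq> 0\<close> by (intro DERIV_add powr_deriv) auto
  then show ?thesis
    by (simp add: hurwitz_numerator_def[abs_def] bernoulli_powr_def bernoulli_0 G_def)
qed

text \<open>With M = m all defects vanish, and the numerator is the Bernoulli polynomial at 1, which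
  equals B_m for m >= 2 but not for m = 1.\<close>

lemma riemann_zeta_1_minus_of_nat:
  assumes "m \<ge> 2"
  shows "riemann_zeta (1 - of_nat m) = - bernoulli m / of_nat m"
proof -
  have "bernoulli_powr m (of_nat m) 1 = (\<Sum>j<Suc m. of_nat (m choose j) * bernoulli j)"
    by (simp add: bernoulli_powr_of_nat lessThan_Suc_atMost)
  also have "\<dots> = bernoulli m"
    using assms by (simp add: sum_binomial_bernoulli)
  finally have "bernoulli_powr m (of_nat m) 1 = bernoulli m" .
  moreover have "bernoulli_defect m (of_nat m) (of_nat n + 1) = 0" for n
    using assms of_nat_neq_0[of n, where 'a = complex] of_nat_neq_0[of "Suc n", where 'a = complex]
    by (intro bernoulli_defect_of_nat) (simp_all add: add_ac)
  ultimately have "hurwitz_numerator m 1 (of_nat m) = bernoulli m"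
    by (simp add: hurwitz_numerator_def)
  then show ?thesis
    using hurwitz_zeta_eq[of m "1 - of_nat m" 1] assms by (simp add: riemann_zeta_def)
qed

section \<open>The harmonic zeta function\<close>

definition harmonic_numerator :: "nat \<Rightarrow> complex \<Rightarrow> complex \<Rightarrow> complex" where
  "harmonic_numerator M a w =
     (\<Sum>j\<le>M. (w gchoose j) * bernoulli j * hurwitz_zeta (of_nat j + 1 - w) a)
     + (\<Sum>n. shifted_harm n a * bernoulli_defect M w (of_nat n + a))"

text \<open>For c(n) = H_n(a) the increments are 1/(n+1+a), and the boundary term B_w(a)/a supplies
  the missing n = 0 summand. The full sum of B_w(n+a)/(n+a) splits into Hurwitz zeta values.\<close>

lemma harmonic_numerator_eq_suminf:
  assumes a: "a \<notin> \<int>\<^sub>\<le>\<^sub>0" and w: "Re w < 0"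
  shows "harmonic_numerator M a w = - w * (\<Sum>n. shifted_harm n a * (of_nat n + a) powr (w - 1))"
proof -
  define x where "x = (\<lambda>n. of_nat n + a)"
  have x: "x n \<noteq> 0" for n
    using of_nat_plus_neq_0[OF a] by (simp add: x_def)
  define D where "D = (\<Sum>n. shifted_harm n a * bernoulli_defect M w (x n))"
  define Z where "Z = (\<Sum>n. shifted_harm n a * x n powr (w - 1))"
  have "(\<lambda>n. (shifted_harm (Suc n) a - shifted_harm n a) * bernoulli_powr M w (x (Suc n))) sums
     - (shifted_harm 0 a * bernoulli_powr M w (x 0) + D + w * Z)"
    using bernoulli_powr_summation_by_parts[OF shifted_harm_subpolynomial[OF a] w, of M a]
    by (simp add: D_def Z_def x_def)
  then have "(\<lambda>n. bernoulli_powr M w (x (Suc n)) / x (Suc n)) sums (- (D + w * Z) - bernoulli_powr M w (x 0) / x 0)"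
    by (simp add: shifted_harm_def x_def algebra_simps)
  then have 1: "(\<lambda>n. bernoulli_powr M w (x n) / x n) sums (- (D + w * Z))"
    by (subst (asm) sums_Suc_iff) simp
  have "(\<lambda>n. \<Sum>j\<le>M. (w gchoose j) * bernoulli j * x n powr (- (of_nat j + 1 - w))) sums
      (\<Sum>j\<le>M. (w gchoose j) * bernoulli j * hurwitz_zeta (of_nat j + 1 - w) a)"
  proof (intro sums_sum sums_mult)
    fix j
    have "summable (\<lambda>n. x n powr (- (of_nat j + 1 - w)))"
      using summable_subpolynomial_powr_complex[OF subpolynomial_const[of 1], of "- (of_nat j + 1 - w)" a] w
      by (simp add: x_def)
    then show "(\<lambda>n. x n powr (- (of_nat j + 1 - w))) sums hurwitz_zeta (of_nat j + 1 - w) a"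
      using w by (simp add: hurwitz_zeta_eq_suminf x_def sums_iff)
  qed
  also have "(\<lambda>n. \<Sum>j\<le>M. (w gchoose j) * bernoulli j * x n powr (- (of_nat j + 1 - w))) =
      (\<lambda>n. bernoulli_powr M w (x n) / x n)"
    using x by (simp add: bernoulli_powr_def sum_divide_distrib powr_diff powr_add fun_eq_iff divide_simps)
  finally have "(\<Sum>j\<le>M. (w gchoose j) * bernoulli j * hurwitz_zeta (of_nat j + 1 - w) a) = - (D + w * Z)"
    using 1 sums_unique2 by blast
  then show ?thesis
    by (simp add: harmonic_numerator_def D_def Z_def x_def)
qed

lemma harmonic_defect_series_analytic [analytic_intros]:
  assumes a: "a \<notin> \<int>\<^sub>\<le>\<^sub>0" and f: "f analytic_on A" "\<And>s. s \<in> A \<Longrightarrow> Re (f s) < real M + 1"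
  shows "(\<lambda>s. \<Sum>n. shifted_harm n a * bernoulli_defect M (f s) (of_nat n + a)) analytic_on A"
proof -
  have "(\<lambda>w. \<Sum>n. shifted_harm n a * bernoulli_defect M w (of_nat n + a)) analytic_on {w. Re w < real M + 1}"
    using defect_series_sums(2)[OF shifted_harm_subpolynomial[OF a]]
    by (simp add: analytic_on_open open_halfspace_Re_lt)
  from analytic_on_compose_gen[OF f(1) this] f(2) show ?thesis by (simp add: o_def)
qed

text \<open>The numerator has poles of its own from the Hurwitz terms, so equality is claimed on
  punctured neighbourhoods, which is all that an O-statement along \<open>at z\<close> sees.\<close>

lemma eventually_harmonic_zeta_eq:
  assumes a: "a \<notin> \<int>\<^sub>\<le>\<^sub>0" and z: "Re z > - real N"
  shows "\<forall>\<^sub>F s in at z. harmonic_zeta s a = harmonic_numerator N a (1 - s) / (s - 1)"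
proof -
  define g where "g = (\<lambda>N s. harmonic_numerator N a (1 - s) / (s - 1))"
  define f where "f = (\<lambda>s. \<Sum>n. shifted_harm n a / (of_nat n + a) powr s)"
  have eq: "g N s = f s" if "Re s > 1" for N s
  proof -
    have "s \<noteq> 1" using that by auto
    then show ?thesis
      using that harmonic_numerator_eq_suminf[OF a, of "1 - s" N]
      by (auto simp: g_def f_def field_simps powr_minus)
  qed
  have hz: "(\<lambda>s. hurwitz_zeta (of_nat j + 1 - (1 - s)) a) meromorphic_on A" for j A
  proof -
    have "(\<lambda>s. hurwitz_zeta s a) meromorphic_on UNIV"
      using hurwitz_zeta_nicely_meromorphic by (simp add: nicely_meromorphic_on_def)
    then show ?thesis
      by (rule meromorphic_on_compose) (auto intro!: analytic_intros)
  qed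
  have gb: "(\<lambda>s. (1 - s) gchoose j) meromorphic_on A" for j :: nat and A :: "complex set"
    by (intro analytic_on_imp_meromorphic_on analytic_intros)
  have ds: "(\<lambda>s. \<Sum>n. shifted_harm n a * bernoulli_defect N (1 - s) (of_nat n + a))
      meromorphic_on {s. Re s > - real N}" for N
    by (intro analytic_on_imp_meromorphic_on analytic_intros a) auto
  have mero: "g N meromorphic_on {s. Re s > - real N}" for N
    unfolding g_def harmonic_numerator_def by (intro meromorphic_intros hz gb ds)
  have "g 0 analytic_on {s. Re s > 1}"
    unfolding g_def harmonic_numerator_def by (intro analytic_intros a) auto
  then have "g 0 holomorphic_on {s. Re s > 1}"
    by (rule analytic_imp_holomorphic)
  then have hol: "f holomorphic_on {s. Re s > 1}"
    by (rule holomorphic_transform) (simp add: eq)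
  have F: "meromorphic_continuation {s. Re s > 1} f = (\<lambda>s. harmonic_zeta s a)"
    by (simp add: harmonic_zeta_def f_def fun_eq_iff)
  show ?thesis
    using meromorphic_continuation_half_planes(3)[where g = g, OF mero hol eq z] by (simp add: F g_def)
qed

section \<open>Laurent expansion at s = 1 - 2k\<close>

lemma gbinomial_has_field_derivative_diagonal:
  "((\<lambda>w. w gchoose n) has_field_derivative harm n) (at (of_nat n :: complex))"
proof (induction n)
  case 0
  then show ?case by (simp add: harm_expand)
next
  case (Suc n)
  have "((\<lambda>w. w - 1) has_field_derivative 1) (at (of_nat (Suc n) :: complex))"
    by (auto intro!: derivative_eq_intros)
  from DERIV_chain2[where f = "\<lambda>w. w gchoose n", OF _ this] Suc
  have "((\<lambda>w. w - 1 gchoose n) has_field_derivative harm n) (at (of_nat (Suc n) :: complex))"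
    by simp
  moreover have "((\<lambda>w. w / of_nat (Suc n)) has_field_derivative 1 / of_nat (Suc n)) (at (of_nat (Suc n) :: complex))"
    by (rule DERIV_cdivide[OF DERIV_ident])
  \<comment> \<open>By absorption this product is \<open>w gchoose Suc n\<close>; both factors equal
    1 at w = n + 1, so their derivatives simply add.\<close>
  ultimately have "((\<lambda>w. w / of_nat (Suc n) * (w - 1 gchoose n)) has_field_derivative
     1 / of_nat (Suc n) * (of_nat (Suc n) - 1 gchoose n) + harm n * (of_nat (Suc n) / of_nat (Suc n)))
     (at (of_nat (Suc n) :: complex))"
    by (intro DERIV_mult)
  also have "1 / of_nat (Suc n) * (of_nat (Suc n) - 1 gchoose n) + harm n * (of_nat (Suc n) / of_nat (Suc n)) =
      (harm (Suc n) :: complex)"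
    by (simp add: harm_Suc inverse_eq_divide flip: binomial_gbinomial del: of_nat_Suc) (simp add: flip: binomial_gbinomial)
  also have "(\<lambda>w :: complex. w / of_nat (Suc n) * (w - 1 gchoose n)) = (\<lambda>w. w gchoose Suc n)"
    by (rule ext) (simp add: gbinomial_absorption')
  finally show ?case .
qed

text \<open>Subtracting Q(z)/(s-z) leaves a difference quotient with a removable singularity of
  value Q'. Adding R gives a holomorphic h, and h(s) - h(z) = O(s-z).\<close>

lemma analytic_simple_pole_expansion:
  assumes Q: "Q analytic_on {z}" "(Q has_field_derivative Q') (at z)" and R: "R analytic_on {z}"
  shows "(\<lambda>s. Q s / (s - z) + R s - (Q z / (s - z) + (Q' + R z))) \<in> O[at z](\<lambda>s. s - z)"
proof -
  obtain e where e: "e > 0" "Q holomorphic_on ball z e" "R holomorphic_on ball z e"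
  proof -
    from Q(1) R obtain e1 e2 where "e1 > 0" "Q holomorphic_on ball z e1" "e2 > 0" "R holomorphic_on ball z e2"
      by (auto simp: analytic_on_def)
    then show ?thesis
      by (intro that[of "min e1 e2"]) (auto elim!: holomorphic_on_subset)
  qed
  define h where "h = (\<lambda>s. (if s = z then deriv Q z else (Q s - Q z) / (s - z)) + R s)"
  have "h holomorphic_on ball z e"
    unfolding h_def using e by (intro holomorphic_intros pole_lemma) auto
  then have "(h has_field_derivative deriv h z) (at z)"
    using e(1) by (intro holomorphic_derivI[of _ "ball z e"]) auto
  then have "((\<lambda>s. (h s - h z) / (s - z)) \<longlongrightarrow> deriv h z) (at z)"
    by (simp add: has_field_derivative_iff)
  then have "(\<lambda>s. h s - h z) \<in> O[at z](\<lambda>s. s - z)"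
    by (rule bigoI_tendsto) (auto simp: eventually_at_filter)
  also have "?this \<longleftrightarrow> ?thesis"
  proof (intro landau_o.big.in_cong)
    have "deriv Q z = Q'" using Q(2) by (rule DERIV_imp_deriv)
    then show "\<forall>\<^sub>F s in at z. h s - h z = Q s / (s - z) + R s - (Q z / (s - z) + (Q' + R z))"
      by (auto simp: eventually_at_filter h_def diff_divide_distrib)
  qed
  finally show ?thesis .
qed

lemma sum_lessThan_double: "(\<Sum>j<2 * k. g j) = (\<Sum>i<k. g (2 * i)) + (\<Sum>i<k. g (2 * i + 1 :: nat))"
  for g :: "nat \<Rightarrow> 'a :: comm_monoid_add"
  by (induction k) (simp_all add: add_ac)

text \<open>Among odd j only j = 1 has a nonzero Bernoulli number, and 2k B_1 = -k. The even indices
  are reversed by j = 2k - 2n, using the symmetry of the binomial coefficients.\<close>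

lemma sum_binomial_bernoulli_hurwitz_zeta:
  assumes k: "k \<ge> 1"
  shows "(\<Sum>j<2 * k. of_nat ((2 * k) choose j) * bernoulli j * hurwitz_zeta (of_nat j + 1 - 2 * of_nat k) a) =
    (\<Sum>n=1..k. of_nat ((2 * k) choose (2 * n)) * hurwitz_zeta (1 - 2 * of_nat n) a * bernoulli (2 * k - 2 * n))
    - of_nat k * hurwitz_zeta (2 - 2 * of_nat k) a"
proof -
  define g where "g = (\<lambda>j. of_nat ((2 * k) choose j) * bernoulli j * hurwitz_zeta (of_nat j + 1 - 2 * of_nat k) a)"
  have "(\<Sum>i<k. g (2 * i + 1)) = (\<Sum>i\<in>{0}. g (2 * i + 1))"
    using k by (intro sum.mono_neutral_right) (auto simp: g_def bernoulli_odd)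
  then have odd: "(\<Sum>i<k. g (2 * i + 1)) = - of_nat k * hurwitz_zeta (2 - 2 * of_nat k) a"
    using bernoulli_1 by (simp add: g_def)
  have even: "(\<Sum>i<k. g (2 * i)) = (\<Sum>n=1..k. of_nat ((2 * k) choose (2 * n)) *
      hurwitz_zeta (1 - 2 * of_nat n) a * bernoulli (2 * k - 2 * n))"
  proof (rule sum.reindex_bij_witness[where i = "\<lambda>n. k - n" and j = "\<lambda>i. k - i"])
    fix i assume i: "i \<in> {..<k}"
    have "(2 * k) choose (2 * (k - i)) = (2 * k) choose (2 * i)"
      using i binomial_symmetric[of "2 * i" "2 * k"] by (simp add: diff_mult_distrib2)
    moreover have "2 * k - 2 * (k - i) = 2 * i" using i by simp
    ultimately show "of_nat ((2 * k) choose (2 * (k - i))) * hurwitz_zeta (1 - 2 * of_nat (k - i)) a *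
        bernoulli (2 * k - 2 * (k - i)) = g (2 * i)"
      using i by (simp add: g_def of_nat_diff algebra_simps)
  qed auto
  from odd even show ?thesis
    using sum_lessThan_double[of g k] by (simp add: g_def)
qed

theorem corollary11:
  fixes k :: nat and a :: complex
  assumes "k \<ge> 2" and "a \<notin> \<int>\<^sub>\<le>\<^sub>0"
  shows "(\<lambda>s. harmonic_zeta s a
            - (riemann_zeta (1 - 2 * of_nat k) / (s + 2 * of_nat k - 1)
               + harmonic_zeta_gamma0 k a))
         \<in> O[at (1 - 2 * of_nat k)](\<lambda>s. s + 2 * of_nat k - 1)"
proof -
  define z :: complex where "z = 1 - 2 * of_nat k"
  define B where "B = bernoulli (2 * k)"
  define D where "D = (\<lambda>w. \<Sum>n. shifted_harm n a * bernoulli_defect (2 * k) w (of_nat n + a))"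
  define C where "C = (\<lambda>s :: complex. 1 - s gchoose (2 * k))"
  define N where "N = (\<lambda>s. hurwitz_numerator 0 a (z - s))"
  \<comment> \<open>Q/(s-z) is the term j = 2k: its Hurwitz factor zeta(2k+s, a) equals N(s)/(s-z),
    as 1 - (2k+s) = z - s. All other terms are regular at z and form R.\<close>
  define Q where "Q = (\<lambda>s. C s * B * N s / (s - 1))"
  define R where "R = (\<lambda>s. ((\<Sum>j<2 * k. (1 - s gchoose j) * bernoulli j * hurwitz_zeta (of_nat j + s) a)
                           + D (1 - s)) / (s - 1))"
  have k0: "of_nat k \<noteq> (0 :: complex)" using assms(1) by simp
  have z1: "z - 1 = - 2 * of_nat k" "1 - z = of_nat (2 * k)" by (simp_all add: z_def)
  then have z1': "z \<noteq> 1" using k0 by auto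
  have Q: "Q analytic_on {z}"
    unfolding Q_def C_def N_def using z1' by (intro analytic_intros) auto
  have R: "R analytic_on {z}"
  proof -
    have "of_nat j + z \<noteq> 1" if "j < 2 * k" for j
    proof -
      have "of_nat j \<noteq> (of_nat (2 * k) :: complex)" using that by (simp only: of_nat_eq_iff)
      then show ?thesis by (simp add: z_def)
    qed
    then show ?thesis
      unfolding R_def D_def using z1' assms(2) by (intro analytic_intros) (auto simp: z_def)
  qed
  \<comment> \<open>Only the value of D at this point enters the constant term; D itself need not
    vanish nearby.\<close>
  have D0: "D (of_nat (2 * k)) = 0"
    unfolding D_def using assms of_nat_plus_neq_0[OF assms(2)] of_nat_plus_neq_0[OF assms(2), of "Suc n" for n]
    by (subst bernoulli_defect_of_nat) (auto simp: add_ac)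
  have Rz: "R z = 1 / 2 * hurwitz_zeta (2 - 2 * of_nat k) a - 1 / (2 * of_nat k) *
      (\<Sum>n=1..k. of_nat ((2 * k) choose (2 * n)) * hurwitz_zeta (1 - 2 * of_nat n) a * bernoulli (2 * k - 2 * n))"
  proof -
    have "R z = (\<Sum>j<2 * k. of_nat ((2 * k) choose j) * bernoulli j *
        hurwitz_zeta (of_nat j + 1 - 2 * of_nat k) a) / (- 2 * of_nat k)"
      unfolding R_def z1 D0 binomial_gbinomial by (simp add: z_def add_diff_eq)
    also have "\<dots> = ((\<Sum>n=1..k. of_nat ((2 * k) choose (2 * n)) * hurwitz_zeta (1 - 2 * of_nat n) a * bernoulli (2 * k - 2 * n))
        - of_nat k * hurwitz_zeta (2 - 2 * of_nat k) a) / (- 2 * of_nat k)"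
      using assms(1) by (subst sum_binomial_bernoulli_hurwitz_zeta) auto
    finally show ?thesis
      using k0 by (simp add: diff_divide_distrib)
  qed
  have Cz: "C z = 1"
    unfolding C_def z1 binomial_gbinomial[symmetric] by simp
  have Nz: "N z = 1"
    by (simp add: N_def hurwitz_numerator_0 assms(2))
  have Qz: "Q z = riemann_zeta (1 - 2 * of_nat k)"
    using riemann_zeta_1_minus_of_nat[of "2 * k"] assms(1)
    by (simp add: Q_def Cz Nz B_def z1)
  have C': "(C has_field_derivative - harm (2 * k)) (at z)"
  proof -
    have "((\<lambda>s. 1 - s) has_field_derivative -1) (at z)"
      by (auto intro!: derivative_eq_intros)
    from DERIV_chain2[where f = "\<lambda>w. w gchoose (2 * k)", OF _ this] gbinomial_has_field_derivative_diagonal[of "2 * k"]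
    show ?thesis by (simp add: C_def z1)
  qed
  have N': "(N has_field_derivative - Digamma a) (at z)"
  proof -
    have "((\<lambda>s. z - s) has_field_derivative -1) (at z)"
      by (auto intro!: derivative_eq_intros)
    from DERIV_chain2[where f = "hurwitz_numerator 0 a", OF _ this] hurwitz_numerator_has_field_derivative_0[OF assms(2)]
    show ?thesis by (simp add: N_def)
  qed
  \<comment> \<open>Logarithmic differentiation: the prefactor is Q(z) = -B/(2k), and C, N and
    1/(s-1) contribute -H_(2k), -psi(a) and 1/(2k), where H_(2k) is \<open>harm (2 * k)\<close>. The
    last one reduces it to the sum up to 2k - 1, which is psi(2k) - psi(1).\<close>
  define Q' where "Q' = B / (2 * of_nat k) * (harm (2 * k) - 1 / (2 * of_nat k) + Digamma a)"
  have Q': "(Q has_field_derivative Q') (at z)"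
    unfolding Q_def
    by (rule derivative_eq_intros C' N' refl)+
      (use z1' k0 in \<open>simp_all add: Q'_def Cz Nz z1 field_simps\<close>)
  have gamma: "Q' + R z = harmonic_zeta_gamma0 k a"
  proof -
    define m where "m = 2 * k - 1"
    define t where "t = bernoulli (2 * k) / (2 * of_nat k)"
    have m: "2 * k = Suc m" using assms(1) by (simp add: m_def)
    have "harm m = (Digamma (2 * of_nat k) + euler_mascheroni :: complex)"
      using Digamma_of_nat[of m, where 'a = complex] unfolding m[symmetric] by simp
    moreover have "harm (2 * k) = harm m + 1 / (2 * of_nat k :: complex)"
      using harm_Suc[of m, where 'a = complex] unfolding m[symmetric] by (simp add: inverse_eq_divide)
    ultimately have "Q' = t * (Digamma (2 * of_nat k) + euler_mascheroni + Digamma a)"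
      by (simp add: Q'_def B_def t_def)
    moreover have "riemann_zeta (1 - 2 * of_nat k) = - t"
      using riemann_zeta_1_minus_of_nat[of "2 * k"] assms(1) by (simp add: t_def)
    ultimately show ?thesis
      unfolding harmonic_zeta_gamma0_def Rz t_def[symmetric] Digamma_1
      by (simp add: algebra_simps)
  qed
  have "\<forall>\<^sub>F s in at z. harmonic_zeta s a = Q s / (s - z) + R s"
  proof -
    \<comment> \<open>This keeps the real part of 2k + s positive, the region where the Hurwitz
      formula with M = 0 is valid.\<close>
    have "\<forall>\<^sub>F s in at z. s \<in> {s. Re s > - real (2 * k)}"
      by (rule eventually_at_in_open'[OF open_halfspace_Re_gt]) (simp add: z_def)
    moreover have "\<forall>\<^sub>F s in at z. s \<noteq> z"
      by (simp add: eventually_at_filter)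
    moreover have "\<forall>\<^sub>F s in at z. harmonic_zeta s a = harmonic_numerator (2 * k) a (1 - s) / (s - 1)"
      by (rule eventually_harmonic_zeta_eq[OF assms(2)]) (simp add: z_def)
    ultimately show ?thesis
    proof eventually_elim
      case (elim s)
      define u where "u = of_nat (2 * k) + s"
      have u: "1 - u = z - s" "u - 1 = s - z" by (simp_all add: u_def z_def)
      then have "u \<noteq> 1" using elim(2) by auto
      moreover have "Re u > - real 0" using elim(1) by (simp add: u_def)
      ultimately have "hurwitz_zeta (of_nat (2 * k) + s) a = N s / (s - z)"
        using hurwitz_zeta_eq[of 0 u a] unfolding u N_def u_def[symmetric] by blast
      then have "harmonic_numerator (2 * k) a (1 - s) = C s * B * (N s / (s - z)) +
         ((\<Sum>j<2 * k. (1 - s gchoose j) * bernoulli j * hurwitz_zeta (of_nat j + s) a) + D (1 - s))"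
        by (simp add: harmonic_numerator_def D_def B_def C_def flip: lessThan_Suc_atMost)
      then show ?case
        unfolding elim(3) Q_def R_def by (simp add: add_divide_distrib mult_ac)
    qed
  qed
  then have "\<forall>\<^sub>F s in at z. harmonic_zeta s a - (riemann_zeta (1 - 2 * of_nat k) / (s - z) + harmonic_zeta_gamma0 k a) =
      Q s / (s - z) + R s - (Q z / (s - z) + (Q' + R z))"
    by eventually_elim (simp add: gamma Qz)
  from landau_o.big.in_cong[OF this]
  have "(\<lambda>s. harmonic_zeta s a - (riemann_zeta (1 - 2 * of_nat k) / (s - z) + harmonic_zeta_gamma0 k a))
      \<in> O[at z](\<lambda>s. s - z)"
    using analytic_simple_pole_expansion[OF Q Q' R] by simp
  moreover have "s - z = s + 2 * of_nat k - 1" for s by (simp add: z_def)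
  ultimately show ?thesis by (simp only: z_def)
qed

end
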